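(* Let $H=(V,E)$ be a hypergraph and $p\colon E\to\mathbb{Q}$ a profit function. Let $f_H$ be the multilinear set of $H$ and $w_p$ the weight function associated with $p$. Then the set of optimal solutions of the problem $\max_{x\in\{0,1\}^V}\sum_{e\in E}p(e)\prod_{v\in e}x(v)$ is equal to $$\{x_{\tau^*}\ :\ \tau^*\text{ is an optimal solution of the Boolean Maximization Problem }(f_H,w_p)\},$$ where for $\tau\in f_H$ the point $x_\tau\in\{0,1\}^V$ is defined by $x_\tau(v)=\tau(x_v)$ for every $v\in V$.
   Context: A hypergraph is a pair $H=(V,E)$ with $V$ finite and $E\subseteq 2^V$. A Boolean function on a finite variable set $Z$ is a subset $f\subseteq\{0,1\}^Z$. A weight function on $Z$ is a map $w\colon Z\times\{0,1\}\to\mathbb{Q}$; for $\tau\in\{0,1\}^Z$ put $w(\tau)=\sum_{z\in Z}w(z,\tau(z))$, and put $w(f)=\max_{\tau\in f}w(\tau)$. An optimal solution of the Boolean Maximization Problem $(f,w)$ is a $\tau^*\in f$ with $w(\tau^* )=w(f)$. The multilinear set $f_H$ of $H$ is the Boolean function on variables $X\cup Y$, where $X=\{x_v\}_{v\in V}$ and $Y=\{y_e\}_{e\in E}$, consisting of all $\tau\in\{0,1\}^{X\cup Y}$ with $\tau(y_e)=\prod_{v\in e}\tau(x_v)$ for every $e\in E$. The weight function $w_p$ is defined by $w_p(x_v,b)=0$ for $v\in V$ and $w_p(y_e,b)=b\cdot p(e)$ for $e\in E$, $b\in\{0,1\}$. *)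

theory Defs
  imports Complex_Main "HOL-Library.FuncSet"
begin

definition hypergraph :: "'v set \<Rightarrow> 'v set set \<Rightarrow> bool" where
  "hypergraph V E \<longleftrightarrow> finite V \<and> E \<subseteq> Pow V"

text \<open>
  The set \<open>{0,1}\<^sup>Z\<close>: extensional functions (with value \<^term>\<open>undefined\<close> outside \<open>Z\<close>), so that
  equality of functions in it is equality on \<open>Z\<close>.  A Boolean function on \<open>Z\<close> is a subset of it.
\<close>
definition assignments :: "'z set \<Rightarrow> ('z \<Rightarrow> nat) set" where
  "assignments Z = Z \<rightarrow>\<^sub>E {0, 1}"

text \<open>A weight function \<open>w\<close> on \<open>Z\<close> is only ever evaluated at \<open>w z b\<close> with \<open>z \<in> Z\<close> and \<open>b \<in> {0,1}\<close>.\<close>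
definition weight :: "'z set \<Rightarrow> ('z \<Rightarrow> nat \<Rightarrow> rat) \<Rightarrow> ('z \<Rightarrow> nat) \<Rightarrow> rat" where
  "weight Z w \<tau> = (\<Sum>z\<in>Z. w z (\<tau> z))"

text \<open>Meaningful for finite \<open>Z\<close> and nonempty \<open>f \<subseteq> {0,1}\<^sup>Z\<close>; multilinear sets are always nonempty.\<close>
definition max_weight :: "'z set \<Rightarrow> ('z \<Rightarrow> nat) set \<Rightarrow> ('z \<Rightarrow> nat \<Rightarrow> rat) \<Rightarrow> rat" where
  "max_weight Z f w = Max (weight Z w ` f)"

definition bmp_optimal ::
    "'z set \<Rightarrow> ('z \<Rightarrow> nat) set \<Rightarrow> ('z \<Rightarrow> nat \<Rightarrow> rat) \<Rightarrow> ('z \<Rightarrow> nat) \<Rightarrow> bool" where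
  "bmp_optimal Z f w \<tau> \<longleftrightarrow> \<tau> \<in> f \<and> weight Z w \<tau> = max_weight Z f w"

datatype 'v mvar = XVar 'v | YVar "'v set"

definition mvars :: "'v set \<Rightarrow> 'v set set \<Rightarrow> 'v mvar set" where
  "mvars V E = XVar ` V \<union> YVar ` E"

definition multilinear_set :: "'v set \<Rightarrow> 'v set set \<Rightarrow> ('v mvar \<Rightarrow> nat) set" where
  "multilinear_set V E =
     {\<tau> \<in> assignments (mvars V E). \<forall>e\<in>E. \<tau> (YVar e) = (\<Prod>v\<in>e. \<tau> (XVar v))}"

fun profit_weight :: "('v set \<Rightarrow> rat) \<Rightarrow> 'v mvar \<Rightarrow> nat \<Rightarrow> rat" where
  "profit_weight p (XVar v) b = 0"
| "profit_weight p (YVar e) b = of_nat b * p e"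

definition bpo_objective :: "'v set set \<Rightarrow> ('v set \<Rightarrow> rat) \<Rightarrow> ('v \<Rightarrow> nat) \<Rightarrow> rat" where
  "bpo_objective E p x = (\<Sum>e\<in>E. p e * (\<Prod>v\<in>e. of_nat (x v)))"

definition bpo_optimal :: "'v set \<Rightarrow> 'v set set \<Rightarrow> ('v set \<Rightarrow> rat) \<Rightarrow> ('v \<Rightarrow> nat) \<Rightarrow> bool" where
  "bpo_optimal V E p = is_arg_max (bpo_objective E p) (\<lambda>x. x \<in> assignments V)"

definition x_point :: "'v set \<Rightarrow> ('v mvar \<Rightarrow> nat) \<Rightarrow> 'v \<Rightarrow> nat" where
  "x_point V \<tau> = restrict (\<lambda>v. \<tau> (XVar v)) V"

end

theory Submission
  imports Defs
begin

text \<open>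
  A point \<open>\<tau>\<close> of the multilinear set is determined by its \<open>x\<close>-coordinates, since each
  \<open>y\<close>-coordinate is a product of these, and the \<open>x\<close>-coordinates may be chosen freely.  Hence
  \<^term>\<open>x_point V\<close> projects the multilinear set onto \<^term>\<open>assignments V\<close>
  (\<open>x_point_image_multilinear_set\<close>).  The weight associated with \<open>p\<close> ignores the
  \<open>x\<close>-coordinates and charges \<open>p e\<close> times the product over \<open>e\<close>, so it is the objective value of
  the projected point (\<open>weight_eq_bpo_objective\<close>).  Maximizers of a function pulled back along a
  surjection are exactly the preimages of the maximizers; this is the claim.
\<close>

lemma finite_mvars:
  assumes "hypergraph V E"
  shows "finite (mvars V E)"
proof -
  have "finite V" and "E \<subseteq> Pow V"
    using assms by (auto simp: hypergraph_def)
  then have "finite E"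
    by (simp add: finite_subset[OF \<open>E \<subseteq> Pow V\<close>])
  with \<open>finite V\<close> show ?thesis
    by (simp add: mvars_def)
qed

lemma finite_multilinear_set:
  assumes "hypergraph V E"
  shows "finite (multilinear_set V E)"
proof (rule finite_subset)
  show "multilinear_set V E \<subseteq> assignments (mvars V E)"
    by (auto simp: multilinear_set_def)
  show "finite (assignments (mvars V E))"
    unfolding assignments_def using finite_mvars[OF assms] by (intro finite_PiE) auto
qed

lemma x_point_mem_assignments:
  assumes "\<tau> \<in> multilinear_set V E"
  shows "x_point V \<tau> \<in> assignments V"
  unfolding assignments_def x_point_def
proof (rule restrict_PiE_iff[THEN iffD2], rule ballI)
  fix v assume "v \<in> V"
  then have "XVar v \<in> mvars V E"
    by (simp add: mvars_def)
  then show "\<tau> (XVar v) \<in> {0, 1}"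
    using assms by (auto simp: multilinear_set_def assignments_def dest: PiE_mem)
qed

text \<open>
  The preimage of \<open>x\<close> extends it by the monomial values \<open>\<Prod>v\<in>e. x v\<close>, which are again
  \<open>0\<close> or \<open>1\<close>.
\<close>
lemma x_point_image_multilinear_set:
  assumes "hypergraph V E"
  shows "x_point V ` multilinear_set V E = assignments V"
proof (intro equalityI subsetI)
  fix x assume "x \<in> x_point V ` multilinear_set V E"
  then show "x \<in> assignments V"
    using x_point_mem_assignments by blast
next
  fix x assume x: "x \<in> assignments V"
  have edge: "e \<subseteq> V" if "e \<in> E" for e
    using assms that by (auto simp: hypergraph_def)
  define \<tau> where "\<tau> =
    restrict (\<lambda>z. case z of XVar v \<Rightarrow> x v | YVar e \<Rightarrow> (\<Prod>v\<in>e. x v)) (mvars V E)"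
  have \<tau>_x: "\<tau> (XVar v) = x v" if "v \<in> V" for v
    using that by (simp add: \<tau>_def mvars_def)
  have \<tau>_y: "\<tau> (YVar e) = (\<Prod>v\<in>e. x v)" if "e \<in> E" for e
    using that by (simp add: \<tau>_def mvars_def)
  have x01: "x v \<in> {0, 1}" if "v \<in> V" for v
    using x that by (auto simp: assignments_def)
  have prod01: "(\<Prod>v\<in>e. x v) \<in> {0, 1}" if "e \<in> E" for e
  proof -
    have "x v \<le> 1" if "v \<in> e" for v
    proof -
      have "v \<in> V"
        using edge[OF \<open>e \<in> E\<close>] that by blast
      then show ?thesis
        using x01[of v] by auto
    qed
    then have "(\<Prod>v\<in>e. x v) \<le> 1"
      by (intro prod_le_1) simp
    then show ?thesis
      by (simp add: le_Suc_eq)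
  qed
  have "\<tau> \<in> assignments (mvars V E)"
    unfolding assignments_def
  proof (rule PiE_I)
    fix z assume "z \<in> mvars V E"
    then consider v where "v \<in> V" "z = XVar v" | e where "e \<in> E" "z = YVar e"
      by (auto simp: mvars_def)
    then show "\<tau> z \<in> {0, 1}"
    proof cases
      case 1
      then show ?thesis using x01[of v] \<tau>_x[of v] by simp
    next
      case 2
      then show ?thesis using prod01[of e] \<tau>_y[of e] by simp
    qed
  qed (simp add: \<tau>_def)
  moreover have "\<tau> (YVar e) = (\<Prod>v\<in>e. \<tau> (XVar v))" if "e \<in> E" for e
    unfolding \<tau>_y[OF that] using \<tau>_x edge[OF that] by (intro prod.cong) auto
  ultimately have "\<tau> \<in> multilinear_set V E"
    by (simp add: multilinear_set_def)
  moreover have "x_point V \<tau> = x"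
  proof
    fix v show "x_point V \<tau> v = x v"
    proof (cases "v \<in> V")
      case True
      then show ?thesis
        by (simp add: x_point_def \<tau>_x)
    next
      case False
      then have "x v = undefined"
        using x unfolding assignments_def by (rule PiE_arb[rotated])
      with False show ?thesis
        by (simp add: x_point_def)
    qed
  qed
  ultimately show "x \<in> x_point V ` multilinear_set V E"
    by blast
qed

lemma weight_eq_bpo_objective:
  assumes H: "hypergraph V E" and \<tau>: "\<tau> \<in> multilinear_set V E"
  shows "weight (mvars V E) (profit_weight p) \<tau> = bpo_objective E p (x_point V \<tau>)"
proof -
  have fin: "finite (XVar ` V \<union> YVar ` E)"
    using finite_mvars[OF H] by (simp add: mvars_def)
  have "weight (mvars V E) (profit_weight p) \<tau> =
      (\<Sum>z\<in>XVar ` V. profit_weight p z (\<tau> z)) + (\<Sum>z\<in>YVar ` E. profit_weight p z (\<tau> z))"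
    unfolding weight_def mvars_def using fin by (intro sum.union_disjoint) auto
  also have "(\<Sum>z\<in>XVar ` V. profit_weight p z (\<tau> z)) = 0"
    by (intro sum.neutral) auto
  also have "(\<Sum>z\<in>YVar ` E. profit_weight p z (\<tau> z)) = (\<Sum>e\<in>E. of_nat (\<tau> (YVar e)) * p e)"
    by (subst sum.reindex) (auto simp: inj_on_def)
  also have "\<dots> = bpo_objective E p (x_point V \<tau>)"
    unfolding bpo_objective_def
  proof (rule sum.cong)
    fix e assume e: "e \<in> E"
    then have "e \<subseteq> V"
      using H by (auto simp: hypergraph_def)
    then have "(\<Prod>v\<in>e. \<tau> (XVar v)) = (\<Prod>v\<in>e. x_point V \<tau> v)"
      by (intro prod.cong) (auto simp: x_point_def)
    then have "\<tau> (YVar e) = (\<Prod>v\<in>e. x_point V \<tau> v)"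
      using e \<tau> by (simp add: multilinear_set_def)
    then show "of_nat (\<tau> (YVar e)) * p e = p e * (\<Prod>v\<in>e. of_nat (x_point V \<tau> v))"
      by (simp add: mult.commute)
  qed simp
  finally show ?thesis by simp
qed

text \<open>
  This removes the numerical maximum from the definition of optimality and leaves the pairwise
  comparison that also defines \<^term>\<open>bpo_optimal\<close>, so that the two notions can be compared.
\<close>
lemma bmp_optimal_iff:
  assumes "finite f"
  shows "bmp_optimal Z f w \<tau> \<longleftrightarrow> \<tau> \<in> f \<and> (\<forall>\<sigma>\<in>f. weight Z w \<sigma> \<le> weight Z w \<tau>)"
proof (cases "\<tau> \<in> f")
  case True
  then have "weight Z w \<tau> = Max (weight Z w ` f) \<longleftrightarrow>
      (\<forall>\<sigma>\<in>f. weight Z w \<sigma> \<le> weight Z w \<tau>)"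
    using assms by (subst eq_Max_iff) auto
  with True show ?thesis
    by (simp add: bmp_optimal_def max_weight_def)
qed (simp add: bmp_optimal_def)

lemma bmp_optimal_multilinear_iff:
  assumes H: "hypergraph V E"
  shows "bmp_optimal (mvars V E) (multilinear_set V E) (profit_weight p) \<tau> \<longleftrightarrow>
    \<tau> \<in> multilinear_set V E \<and> bpo_optimal V E p (x_point V \<tau>)"
proof (cases "\<tau> \<in> multilinear_set V E")
  case True
  have "bmp_optimal (mvars V E) (multilinear_set V E) (profit_weight p) \<tau> \<longleftrightarrow>
      (\<forall>\<sigma>\<in>multilinear_set V E.
        bpo_objective E p (x_point V \<sigma>) \<le> bpo_objective E p (x_point V \<tau>))"
    using True by (simp add: bmp_optimal_iff[OF finite_multilinear_set[OF H]]
        weight_eq_bpo_objective[OF H])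
  also have "\<dots> \<longleftrightarrow> (\<forall>x\<in>assignments V. bpo_objective E p x \<le> bpo_objective E p (x_point V \<tau>))"
    by (simp flip: x_point_image_multilinear_set[OF H])
  also have "\<dots> \<longleftrightarrow> bpo_optimal V E p (x_point V \<tau>)"
    using x_point_mem_assignments[OF True]
    by (auto simp: bpo_optimal_def is_arg_max_linorder)
  finally show ?thesis
    using True by simp
qed (simp add: bmp_optimal_def)

theorem theorem3:
  fixes V :: "'v set" and E :: "'v set set" and p :: "'v set \<Rightarrow> rat"
  assumes "hypergraph V E"
  shows "{x. bpo_optimal V E p x} =
    {x_point V \<tau> | \<tau>. bmp_optimal (mvars V E) (multilinear_set V E) (profit_weight p) \<tau>}"
proof -
  have "x \<in> x_point V ` multilinear_set V E" if "bpo_optimal V E p x" for x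
    using that unfolding x_point_image_multilinear_set[OF assms]
    by (simp add: bpo_optimal_def is_arg_max_linorder)
  then show ?thesis
    unfolding bmp_optimal_multilinear_iff[OF assms] by blast
qed

end
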